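(* Let $\Phi$ be a reduced crystallographic root system with set of simple roots $\Delta$ and positive roots $\Phi^+$. For any subset $\Delta_P\subset\Delta$, the inequality $$\sum_{\beta\in\Delta\setminus\Delta_P}\Biggl(\Bigl(\sum_{\alpha\in\Phi^+\setminus\Phi_{\Delta_P}^+}\langle\alpha,\beta^\vee\rangle\Bigr)-1\Biggr)\le|\Phi^+\setminus\Phi_{\Delta_P}^+|$$ holds. As a consequence, $$|\Delta\setminus\Delta_P|\cdot\Biggl(\gcd_{\beta\in\Delta\setminus\Delta_P}\Bigl(\sum_{\alpha\in\Phi^+\setminus\Phi_{\Delta_P}^+}\langle\alpha,\beta^\vee\rangle\Bigr)-1\Biggr)\le|\Phi^+\setminus\Phi_{\Delta_P}^+|.$$
   Context: $\Phi$ lies in a Euclidean space with inner product $\langle\cdot,\cdot\rangle$; for a root $\beta$, $\beta^\vee=2\beta/\langle\beta,\beta\rangle$. $\Phi_{\Delta_P}^+$ denotes the set of positive roots generated by $\Delta_P$, i.e. the positive roots in the span of $\Delta_P$. In the first inequality the $-1$ is subtracted once for each $\beta$, outside the sum over $\alpha$. The $\gcd$ is the greatest common divisor of the indicated integers as $\beta$ ranges over $\Delta\setminus\Delta_P$. *)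

theory Defs
  imports "HOL-Analysis.Analysis"
begin

definition coroot :: "'a::euclidean_space \<Rightarrow> 'a" where
  "coroot \<beta> = (2 / (\<beta> \<bullet> \<beta>)) *\<^sub>R \<beta>"

text \<open>
  A root system spans its Euclidean space by convention; here that space is \<open>span \<Phi>\<close>, which may
  be a proper subspace of the ambient type. Since Euclidean types have positive dimension, this
  also keeps the empty root system (of rank zero).
\<close>

definition root_system :: "'a::euclidean_space set \<Rightarrow> bool" where
  "root_system \<Phi> \<longleftrightarrow>
     finite \<Phi> \<and> 0 \<notin> \<Phi> \<and>
     (\<forall>\<alpha>\<in>\<Phi>. \<forall>\<beta>\<in>\<Phi>. \<beta> - (\<beta> \<bullet> coroot \<alpha>) *\<^sub>R \<alpha> \<in> \<Phi>)"

definition crystallographic :: "'a::euclidean_space set \<Rightarrow> bool" where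
  "crystallographic \<Phi> \<longleftrightarrow> (\<forall>\<alpha>\<in>\<Phi>. \<forall>\<beta>\<in>\<Phi>. \<beta> \<bullet> coroot \<alpha> \<in> \<int>)"

definition reduced_roots :: "'a::euclidean_space set \<Rightarrow> bool" where
  "reduced_roots \<Phi> \<longleftrightarrow> (\<forall>\<alpha>\<in>\<Phi>. \<forall>c. c *\<^sub>R \<alpha> \<in> \<Phi> \<longrightarrow> c = 1 \<or> c = -1)"

definition positive_roots :: "'a::euclidean_space set \<Rightarrow> 'a set \<Rightarrow> 'a set" where
  "positive_roots \<Phi> \<Delta> = {\<alpha> \<in> \<Phi>. \<exists>c :: 'a \<Rightarrow> nat. \<alpha> = (\<Sum>\<delta>\<in>\<Delta>. real (c \<delta>) *\<^sub>R \<delta>)}"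

definition simple_roots :: "'a::euclidean_space set \<Rightarrow> 'a set \<Rightarrow> bool" where
  "simple_roots \<Phi> \<Delta> \<longleftrightarrow>
     \<Delta> \<subseteq> \<Phi> \<and> independent \<Delta> \<and>
     (\<forall>\<alpha>\<in>\<Phi>. \<alpha> \<in> positive_roots \<Phi> \<Delta> \<or> - \<alpha> \<in> positive_roots \<Phi> \<Delta>)"

text \<open>\<open>complementary_roots \<Phi> \<Delta> \<Delta>\<^sub>P\<close> is $\Phi^+ \setminus \Phi_{\Delta_P}^+$.\<close>

definition complementary_roots ::
    "'a::euclidean_space set \<Rightarrow> 'a set \<Rightarrow> 'a set \<Rightarrow> 'a set" where
  "complementary_roots \<Phi> \<Delta> \<Delta>\<^sub>P =
     positive_roots \<Phi> \<Delta> - (positive_roots \<Phi> \<Delta> \<inter> span \<Delta>\<^sub>P)"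

definition pairing_sum ::
    "'a::euclidean_space set \<Rightarrow> 'a set \<Rightarrow> 'a set \<Rightarrow> 'a \<Rightarrow> real" where
  "pairing_sum \<Phi> \<Delta> \<Delta>\<^sub>P \<beta> = (\<Sum>\<alpha>\<in>complementary_roots \<Phi> \<Delta> \<Delta>\<^sub>P. \<alpha> \<bullet> coroot \<beta>)"

text \<open>
  The gcd is taken in the integers, so the (real-valued, but integral) sums are converted with the
  floor function, which by this lemma does not change their value.
\<close>

lemma of_int_floor_pairing_sum:
  assumes "crystallographic \<Phi>" and "\<beta> \<in> \<Phi>"
  shows "of_int \<lfloor>pairing_sum \<Phi> \<Delta> \<Delta>\<^sub>P \<beta>\<rfloor> = pairing_sum \<Phi> \<Delta> \<Delta>\<^sub>P \<beta>"
proof -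
  have "pairing_sum \<Phi> \<Delta> \<Delta>\<^sub>P \<beta> \<in> \<int>"
    using assms unfolding pairing_sum_def complementary_roots_def positive_roots_def
      crystallographic_def
    by (intro Ints_sum) auto
  then show ?thesis
    by (rule of_int_floor)
qed

end

theory Submission
  imports Defs
begin

text \<open>
  Let \<open>\<beta> \<in> \<Delta> - \<Delta>\<^sub>P\<close>. The reflection in \<open>\<beta>\<close> permutes the positive roots other than \<open>\<beta>\<close>, so the pairings
  of all positive roots with \<open>coroot \<beta>\<close> add up to 2, and \<open>pairing_sum \<Phi> \<Delta> \<Delta>\<^sub>P \<beta> - 1\<close> equals 1 plus
  the sum of the numbers \<open>- (\<gamma> \<bullet> coroot \<beta>) \<ge> 0\<close> over the positive roots \<open>\<gamma>\<close> in the span of \<open>\<Delta>\<^sub>P\<close>. For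
  such \<open>\<gamma>\<close>, the \<open>\<beta>\<close>-string through \<open>\<gamma>\<close> consists of the roots \<open>\<gamma> + j \<beta>\<close> with
  \<open>0 \<le> j \<le> - (\<gamma> \<bullet> coroot \<beta>)\<close>. Hence the left-hand side counts the simple roots \<open>\<beta>\<close> outside \<open>\<Delta>\<^sub>P\<close> and
  the roots \<open>\<gamma> + j \<beta>\<close> with \<open>j \<ge> 1\<close>; these are pairwise distinct complementary roots.
\<close>

section \<open>Root systems with a base\<close>

locale root_basis =
  fixes \<Phi> \<Delta> :: "'a::euclidean_space set"
  assumes root_system: "root_system \<Phi>"
    and crystallographic: "crystallographic \<Phi>"
    and reduced: "reduced_roots \<Phi>"
    and simple: "simple_roots \<Phi> \<Delta>"
begin

lemma finite_roots: "finite \<Phi>"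
  and zero_not_root: "0 \<notin> \<Phi>"
  and reflection_root: "\<lbrakk>\<alpha> \<in> \<Phi>; \<beta> \<in> \<Phi>\<rbrakk> \<Longrightarrow> \<beta> - (\<beta> \<bullet> coroot \<alpha>) *\<^sub>R \<alpha> \<in> \<Phi>"
  and pairing_Ints: "\<lbrakk>\<alpha> \<in> \<Phi>; \<beta> \<in> \<Phi>\<rbrakk> \<Longrightarrow> \<beta> \<bullet> coroot \<alpha> \<in> \<int>"
  and simple_subset: "\<Delta> \<subseteq> \<Phi>"
  and simple_independent: "independent \<Delta>"
  using root_system crystallographic simple
  by (auto simp: root_system_def crystallographic_def simple_roots_def)

lemma finite_simple: "finite \<Delta>"
  using finite_roots simple_subset finite_subset by blast

lemma pairing_coroot_self: "\<alpha> \<in> \<Phi> \<Longrightarrow> \<alpha> \<bullet> coroot \<alpha> = 2"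
  using zero_not_root by (auto simp: coroot_def)

lemma root_in_span: "\<alpha> \<in> \<Phi> \<Longrightarrow> \<alpha> \<in> span \<Delta>"
proof -
  have *: "\<alpha> \<in> span \<Delta>" if "\<alpha> \<in> positive_roots \<Phi> \<Delta>" for \<alpha>
    using that unfolding positive_roots_def by (blast intro: span_sum span_scale span_base)
  assume "\<alpha> \<in> \<Phi>"
  then have "\<alpha> \<in> positive_roots \<Phi> \<Delta> \<or> - \<alpha> \<in> positive_roots \<Phi> \<Delta>"
    using simple by (auto simp: simple_roots_def)
  then show ?thesis
    using *[of \<alpha>] *[of "- \<alpha>"] span_neg[of "- \<alpha>"] by auto
qed

section \<open>Coordinates in the basis of simple roots\<close>

abbreviation coef :: "'a \<Rightarrow> 'a \<Rightarrow> real" where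
  "coef \<equiv> representation \<Delta>"

lemma sum_coef: "v \<in> span \<Delta> \<Longrightarrow> (\<Sum>\<delta>\<in>\<Delta>. coef v \<delta> *\<^sub>R \<delta>) = v"
  using real_vector.sum_representation_eq[OF simple_independent _ finite_simple] by blast

lemma coef_simple: "\<beta> \<in> \<Delta> \<Longrightarrow> coef \<beta> \<delta> = (if \<delta> = \<beta> then 1 else 0)"
  using real_vector.representation_basis[OF simple_independent] by auto

text \<open>Reflections in a simple root and steps along its strings move a single coordinate; the
  later sign and injectivity arguments rest on this.\<close>

lemma coef_add_simple:
  assumes "v \<in> span \<Delta>" "\<beta> \<in> \<Delta>"
  shows "coef (v + c *\<^sub>R \<beta>) \<delta> = coef v \<delta> + (if \<delta> = \<beta> then c else 0)"
  using assms
  by (simp add: real_vector.representation_add[OF simple_independent]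
      real_vector.representation_scale[OF simple_independent] span_base span_scale coef_simple)

lemma coef_diff_simple:
  assumes "v \<in> span \<Delta>" "\<beta> \<in> \<Delta>"
  shows "coef (v - c *\<^sub>R \<beta>) \<delta> = coef v \<delta> - (if \<delta> = \<beta> then c else 0)"
  using coef_add_simple[OF assms, of "- c" \<delta>] by simp

lemma positive_coef_nonneg:
  assumes "\<alpha> \<in> positive_roots \<Phi> \<Delta>"
  shows "coef \<alpha> \<delta> \<ge> 0"
proof -
  obtain c :: "'a \<Rightarrow> nat" where c: "\<alpha> = (\<Sum>\<delta>\<in>\<Delta>. real (c \<delta>) *\<^sub>R \<delta>)"
    using assms by (auto simp: positive_roots_def)
  have "coef \<alpha> \<delta> = (\<Sum>\<epsilon>\<in>\<Delta>. coef (real (c \<epsilon>) *\<^sub>R \<epsilon>) \<delta>)"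
    unfolding c
    by (simp add: real_vector.representation_sum[OF simple_independent] span_base span_scale)
  also have "\<dots> \<ge> 0"
    by (intro sum_nonneg)
      (simp add: real_vector.representation_scale[OF simple_independent] span_base coef_simple)
  finally show ?thesis .
qed

text \<open>The coordinates of a root never have mixed signs, so one positive coordinate rules out
  that \<open>- \<alpha>\<close> is the positive one.\<close>

lemma positive_rootI:
  assumes "\<alpha> \<in> \<Phi>" "coef \<alpha> \<delta> > 0"
  shows "\<alpha> \<in> positive_roots \<Phi> \<Delta>"
proof (rule ccontr)
  assume "\<alpha> \<notin> positive_roots \<Phi> \<Delta>"
  then have "- \<alpha> \<in> positive_roots \<Phi> \<Delta>"
    using assms simple by (auto simp: simple_roots_def)
  then have "coef (- \<alpha>) \<delta> \<ge> 0"
    by (rule positive_coef_nonneg)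
  then show False
    using assms by (simp add: real_vector.representation_neg[OF simple_independent] root_in_span)
qed

lemma coef_eq_0_of_span:
  assumes "v \<in> span P" "P \<subseteq> \<Delta>" "\<delta> \<notin> P"
  shows "coef v \<delta> = 0"
  using assms real_vector.representation_extend[OF simple_independent assms(1,2)]
    real_vector.representation_ne_zero[of P v \<delta>] by auto

section \<open>Reflections in simple roots\<close>

lemma positive_reflection:
  assumes \<alpha>: "\<alpha> \<in> positive_roots \<Phi> \<Delta> - {\<beta>}" and \<beta>: "\<beta> \<in> \<Delta>"
  shows "\<alpha> - (\<alpha> \<bullet> coroot \<beta>) *\<^sub>R \<beta> \<in> positive_roots \<Phi> \<Delta> - {\<beta>}"
proof -
  have root: "\<alpha> \<in> \<Phi>" and \<beta>\<Phi>: "\<beta> \<in> \<Phi>"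
    using \<alpha> \<beta> simple_subset by (auto simp: positive_roots_def)
  \<comment> \<open>The reflection alters only the \<open>\<beta>\<close>-coordinate, so a positive
    coordinate elsewhere survives and keeps the image positive. Without one, \<open>\<alpha>\<close>
    would be a multiple of \<open>\<beta>\<close>, and reducedness leaves only
    \<open>\<beta>\<close> and \<open>- \<beta>\<close>.\<close>
  have "\<exists>\<delta>\<in>\<Delta>. \<delta> \<noteq> \<beta> \<and> coef \<alpha> \<delta> > 0"
  proof (rule ccontr)
    assume "\<not> ?thesis"
    then have zero: "coef \<alpha> \<delta> = 0" if "\<delta> \<in> \<Delta>" "\<delta> \<noteq> \<beta>" for \<delta>
      using that positive_coef_nonneg[of \<alpha> \<delta>] \<alpha> by force
    have "\<alpha> = (\<Sum>\<delta>\<in>\<Delta>. coef \<alpha> \<delta> *\<^sub>R \<delta>)"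
      using sum_coef root root_in_span by simp
    also have "\<dots> = (\<Sum>\<delta>\<in>{\<beta>}. coef \<alpha> \<delta> *\<^sub>R \<delta>)"
      using \<beta> zero by (intro sum.mono_neutral_right finite_simple) auto
    finally have eq: "\<alpha> = coef \<alpha> \<beta> *\<^sub>R \<beta>" by simp
    then have "coef \<alpha> \<beta> = 1 \<or> coef \<alpha> \<beta> = -1"
      using reduced root \<beta>\<Phi> unfolding reduced_roots_def by metis
    then show False
      using eq \<alpha> positive_coef_nonneg[of \<alpha> \<beta>] by auto
  qed
  then obtain \<delta> where \<delta>: "\<delta> \<in> \<Delta>" "\<delta> \<noteq> \<beta>" "coef \<alpha> \<delta> > 0" by blast
  have "coef (\<alpha> - (\<alpha> \<bullet> coroot \<beta>) *\<^sub>R \<beta>) \<delta> > 0"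
    using \<delta> \<beta> root by (simp add: coef_diff_simple root_in_span)
  moreover have "coef \<beta> \<delta> = 0"
    using \<delta> \<beta> by (simp add: coef_simple)
  ultimately show ?thesis
    using positive_rootI[OF reflection_root[OF \<beta>\<Phi> root]] by auto
qed

lemma sum_pairing_positive:
  assumes \<beta>: "\<beta> \<in> \<Delta>"
  shows "(\<Sum>\<alpha>\<in>positive_roots \<Phi> \<Delta>. \<alpha> \<bullet> coroot \<beta>) = 2"
proof -
  let ?P = "positive_roots \<Phi> \<Delta>" and ?s = "\<lambda>\<alpha>. \<alpha> - (\<alpha> \<bullet> coroot \<beta>) *\<^sub>R \<beta>"
  have \<beta>\<Phi>: "\<beta> \<in> \<Phi>" using \<beta> simple_subset by auto
  have fin: "finite ?P" using finite_roots by (auto simp: positive_roots_def)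
  have \<beta>P: "\<beta> \<in> ?P"
    using \<beta> \<beta>\<Phi> by (intro positive_rootI[of _ \<beta>]) (auto simp: coef_simple)
  have neg: "?s \<alpha> \<bullet> coroot \<beta> = - (\<alpha> \<bullet> coroot \<beta>)" for \<alpha>
    by (simp add: inner_diff_left pairing_coroot_self[OF \<beta>\<Phi>])
  \<comment> \<open>\<open>?s\<close> is an involution of the index set that negates the pairing, so
    the sum equals its own negative.\<close>
  have "(\<Sum>\<alpha>\<in>?P - {\<beta>}. \<alpha> \<bullet> coroot \<beta>) = (\<Sum>\<alpha>\<in>?P - {\<beta>}. - (\<alpha> \<bullet> coroot \<beta>))"
    by (rule sum.reindex_bij_witness[of _ ?s ?s])
      (use positive_reflection[OF _ \<beta>] in \<open>simp_all add: neg del: Diff_iff\<close>)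
  then have "(\<Sum>\<alpha>\<in>?P - {\<beta>}. \<alpha> \<bullet> coroot \<beta>) = 0"
    by (simp add: sum_negf)
  then show ?thesis
    using sum.remove[OF fin \<beta>P, of "\<lambda>\<alpha>. \<alpha> \<bullet> coroot \<beta>"] by (simp add: pairing_coroot_self[OF \<beta>\<Phi>])
qed

section \<open>Root strings\<close>

lemma add_root:
  assumes \<alpha>: "\<alpha> \<in> \<Phi>" and \<beta>: "\<beta> \<in> \<Phi>" and neg: "\<alpha> \<bullet> \<beta> < 0" and np: "\<alpha> \<notin> span {\<beta>}"
  shows "\<alpha> + \<beta> \<in> \<Phi>"
proof -
  have pos: "\<alpha> \<bullet> \<alpha> > 0" "\<beta> \<bullet> \<beta> > 0"
    using \<alpha> \<beta> zero_not_root by (auto simp: inner_gt_zero_iff)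
  obtain m n :: int where m: "\<alpha> \<bullet> coroot \<beta> = of_int m" and n: "\<beta> \<bullet> coroot \<alpha> = of_int n"
    using pairing_Ints \<alpha> \<beta> by (meson Ints_cases)
  have mv: "of_int m = 2 * (\<alpha> \<bullet> \<beta>) / (\<beta> \<bullet> \<beta>)" and nv: "of_int n = 2 * (\<alpha> \<bullet> \<beta>) / (\<alpha> \<bullet> \<alpha>)"
    using m n by (simp_all add: coroot_def inner_commute)
  have mn: "m < 0" "n < 0"
    using neg pos mv nv by (simp_all add: divide_neg_pos flip: of_int_less_0_iff[where 'a = real])
  \<comment> \<open>Strict Cauchy-Schwarz: by \<open>np\<close> the component of
    \<open>\<alpha>\<close> orthogonal to \<open>\<beta>\<close> is nonzero, so its squared norm is
    positive.\<close>
  have "(\<alpha> \<bullet> \<beta>)\<^sup>2 < (\<alpha> \<bullet> \<alpha>) * (\<beta> \<bullet> \<beta>)"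
  proof -
    let ?c = "(\<alpha> \<bullet> \<beta>) / (\<beta> \<bullet> \<beta>)"
    have "\<alpha> - ?c *\<^sub>R \<beta> \<noteq> 0"
      using np span_scale[OF span_base[of \<beta> "{\<beta>}"], of ?c] by auto
    then have "0 < (\<alpha> - ?c *\<^sub>R \<beta>) \<bullet> (\<alpha> - ?c *\<^sub>R \<beta>)"
      using inner_gt_zero_iff by blast
    also have "\<dots> = \<alpha> \<bullet> \<alpha> - (\<alpha> \<bullet> \<beta>)\<^sup>2 / (\<beta> \<bullet> \<beta>)"
      using pos by (simp add: inner_diff_left inner_diff_right inner_commute power2_eq_square)
    finally show ?thesis
      using pos by (simp add: field_simps)
  qed
  then have "of_int m * of_int n < (4::real)"
    using pos unfolding mv nv by (simp add: field_simps power2_eq_square)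
  then have lt: "m * n < 4"
    by (simp flip: of_int_mult)
  \<comment> \<open>If \<open>m = -1\<close>, reflecting \<open>\<alpha>\<close> in
    \<open>\<beta>\<close> produces the sum; if \<open>n = -1\<close>, reflecting
    \<open>\<beta>\<close> in \<open>\<alpha>\<close> does.\<close>
  have "m = -1 \<or> n = -1"
  proof (rule ccontr)
    assume "\<not> ?thesis"
    then have "m \<le> -2" "n \<le> -2" using mn by auto
    then have "2 * 2 \<le> (- m) * (- n)" by (intro mult_mono) auto
    then show False using lt by simp
  qed
  then show ?thesis
    using reflection_root[OF \<alpha> \<beta>] reflection_root[OF \<beta> \<alpha>] m n by (auto simp: add.commute)
qed

text \<open>Up to its midpoint the string is built by repeated use of \<open>add_root\<close>; the
  remainder is the mirror image under the reflection in \<open>\<beta>\<close>.\<close>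

lemma root_string:
  assumes \<gamma>: "\<gamma> \<in> \<Phi>" and \<beta>: "\<beta> \<in> \<Phi>" and np: "\<gamma> \<notin> span {\<beta>}"
    and j: "real j \<le> - (\<gamma> \<bullet> coroot \<beta>)"
  shows "\<gamma> + real j *\<^sub>R \<beta> \<in> \<Phi>"
proof -
  have pair: "(\<gamma> + c *\<^sub>R \<beta>) \<bullet> coroot \<beta> = \<gamma> \<bullet> coroot \<beta> + 2 * c" for c
    by (simp add: inner_add_left pairing_coroot_self[OF \<beta>])
  have half: "\<gamma> + real i *\<^sub>R \<beta> \<in> \<Phi>" if "2 * real i \<le> 1 - (\<gamma> \<bullet> coroot \<beta>)" for i
    using that
  proof (induction i)
    case 0
    then show ?case using \<gamma> by simp
  next
    case (Suc i)
    let ?\<alpha> = "\<gamma> + real i *\<^sub>R \<beta>"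
    have root: "?\<alpha> \<in> \<Phi>" using Suc by simp
    \<comment> \<open>The bound for \<open>Suc i\<close> makes this pairing at most -1.\<close>
    have "?\<alpha> \<bullet> coroot \<beta> < 0" using Suc.prems pair[of "real i"] by simp
    then have "?\<alpha> \<bullet> \<beta> < 0"
      by (auto simp: coroot_def divide_less_0_iff mult_less_0_iff not_less[symmetric]
          dest: less_le_trans[OF _ inner_ge_zero])
    moreover have "?\<alpha> \<notin> span {\<beta>}"
      using np span_add_eq2[of "real i *\<^sub>R \<beta>" "{\<beta>}" \<gamma>] by (simp add: span_base span_scale)
    ultimately have "?\<alpha> + \<beta> \<in> \<Phi>" using add_root[OF root \<beta>] by blast
    then show ?case by (simp add: algebra_simps)
  qed
  show ?thesis
  proof (cases "2 * real j \<le> - (\<gamma> \<bullet> coroot \<beta>)")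
    case True
    then show ?thesis by (intro half) simp
  next
    case False
    obtain m :: int where m: "\<gamma> \<bullet> coroot \<beta> = of_int m"
      using pairing_Ints \<gamma> \<beta> by (meson Ints_cases)
    \<comment> \<open>The reflection in \<open>\<beta>\<close> sends the coefficient
      \<open>i\<close> to \<open>- m - i\<close>, so this index is the mirror image of
      \<open>j\<close>. As \<open>j\<close> lies past the midpoint, \<open>i\<close> lies before it,
      within reach of \<open>half\<close>.\<close>
    define i where "i = nat (- m - int j)"
    have i: "real i = - (\<gamma> \<bullet> coroot \<beta>) - real j"
      using j m by (simp add: i_def)
    have "\<gamma> + real i *\<^sub>R \<beta> \<in> \<Phi>"
      using False by (intro half) (simp add: i)
    from reflection_root[OF \<beta> this]
    have "\<gamma> + (real i - (\<gamma> \<bullet> coroot \<beta> + 2 * real i)) *\<^sub>R \<beta> \<in> \<Phi>"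
      by (simp only: pair scaleR_diff_left add_diff_eq)
    then show ?thesis
      by (simp add: i)
  qed
qed

end

section \<open>Positive roots in the span of \<open>\<Delta>\<^sub>P\<close>\<close>

locale parabolic_root_basis = root_basis +
  fixes \<Delta>\<^sub>P :: "'a set"
  assumes parabolic_subset: "\<Delta>\<^sub>P \<subseteq> \<Delta>"
begin

abbreviation levi_roots :: "'a set" where
  "levi_roots \<equiv> positive_roots \<Phi> \<Delta> \<inter> span \<Delta>\<^sub>P"

lemma levi_coef_eq_0: "\<lbrakk>\<gamma> \<in> span \<Delta>\<^sub>P; \<delta> \<notin> \<Delta>\<^sub>P\<rbrakk> \<Longrightarrow> coef \<gamma> \<delta> = 0"
  using coef_eq_0_of_span parabolic_subset by blast

text \<open>The \<open>\<beta>\<close>-coordinate of \<open>\<gamma>\<close> is 0, so that of its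
  reflection in \<open>\<beta>\<close> is \<open>- (\<gamma> \<bullet> coroot \<beta>)\<close>; the
  reflection is again a positive root.\<close>

lemma levi_pairing_nonpos:
  assumes \<gamma>: "\<gamma> \<in> levi_roots" and \<beta>: "\<beta> \<in> \<Delta> - \<Delta>\<^sub>P"
  shows "\<gamma> \<bullet> coroot \<beta> \<le> 0"
proof -
  have root: "\<gamma> \<in> \<Phi>" using \<gamma> by (auto simp: positive_roots_def)
  have "coef \<beta> \<beta> \<noteq> 0" using \<beta> by (simp add: coef_simple)
  then have "\<gamma> \<noteq> \<beta>" using \<gamma> \<beta> levi_coef_eq_0 by blast
  then have "\<gamma> - (\<gamma> \<bullet> coroot \<beta>) *\<^sub>R \<beta> \<in> positive_roots \<Phi> \<Delta>"
    using positive_reflection[of \<gamma> \<beta>] \<gamma> \<beta> by auto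
  then have "coef (\<gamma> - (\<gamma> \<bullet> coroot \<beta>) *\<^sub>R \<beta>) \<beta> \<ge> 0"
    by (rule positive_coef_nonneg)
  then show ?thesis
    using \<gamma> \<beta> root by (simp add: coef_diff_simple root_in_span levi_coef_eq_0)
qed

lemma pairing_sum_eq:
  assumes \<beta>: "\<beta> \<in> \<Delta>"
  shows "pairing_sum \<Phi> \<Delta> \<Delta>\<^sub>P \<beta> = 2 + (\<Sum>\<gamma>\<in>levi_roots. - (\<gamma> \<bullet> coroot \<beta>))"
proof -
  have "finite (positive_roots \<Phi> \<Delta>)" using finite_roots by (auto simp: positive_roots_def)
  then show ?thesis
    unfolding pairing_sum_def complementary_roots_def
    by (simp add: sum_diff sum_pairing_positive[OF \<beta>] sum_negf del: Diff_Int)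
qed

text \<open>One coordinate does two things: its sign makes the root positive, and its being nonzero
  keeps the root out of \<open>span \<Delta>\<^sub>P\<close>.\<close>

lemma complementary_rootI:
  assumes root: "\<alpha> \<in> \<Phi>" and \<beta>: "\<beta> \<in> \<Delta> - \<Delta>\<^sub>P" and pos: "coef \<alpha> \<beta> > 0"
  shows "\<alpha> \<in> complementary_roots \<Phi> \<Delta> \<Delta>\<^sub>P"
  using positive_rootI[OF root pos] levi_coef_eq_0[of \<alpha> \<beta>] \<beta> pos
  by (auto simp: complementary_roots_def)

section \<open>Counting by an injection into the complementary roots\<close>

lemma sum_pairing_sum_le_card:
  "(\<Sum>\<beta>\<in>\<Delta> - \<Delta>\<^sub>P. (pairing_sum \<Phi> \<Delta> \<Delta>\<^sub>P \<beta> - 1)) \<le> real (card (complementary_roots \<Phi> \<Delta> \<Delta>\<^sub>P))"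
proof -
  \<comment> \<open>For the pairs in use the pairing is an integer and nonpositive, so neither the
    floor nor \<open>nat\<close> changes the value.\<close>
  define k where "k \<beta> \<gamma> = nat \<lfloor>- (\<gamma> \<bullet> coroot \<beta>)\<rfloor>" for \<beta> \<gamma> :: 'a
  \<comment> \<open>The index \<open>(0, 1)\<close> encodes the simple root \<open>\<beta>\<close> itself.\<close>
  define I where "I \<beta> = insert (0, 1) (SIGMA \<gamma>:levi_roots. {1..k \<beta> \<gamma>})" for \<beta> :: 'a
  define f where "f = (\<lambda>(\<beta> :: 'a, \<gamma> :: 'a, j :: nat). \<gamma> + real j *\<^sub>R \<beta>)"
  have fin: "finite levi_roots" "finite (complementary_roots \<Phi> \<Delta> \<Delta>\<^sub>P)"
    using finite_roots by (auto simp: positive_roots_def complementary_roots_def)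
  have levi_root: "\<gamma> \<in> \<Phi>" if "\<gamma> \<in> levi_roots" for \<gamma>
    using that by (auto simp: positive_roots_def)
  have k: "real (k \<beta> \<gamma>) = - (\<gamma> \<bullet> coroot \<beta>)" if "\<gamma> \<in> levi_roots" "\<beta> \<in> \<Delta> - \<Delta>\<^sub>P" for \<beta> \<gamma>
  proof -
    have "\<gamma> \<bullet> coroot \<beta> \<in> \<int>"
      using that levi_root simple_subset by (intro pairing_Ints) auto
    then show ?thesis
      using levi_pairing_nonpos[OF that] by (auto simp: k_def elim!: Ints_cases)
  qed
  have index: "\<gamma> \<in> span \<Delta>\<^sub>P" "j \<ge> 1" if "(\<gamma>, j) \<in> I \<beta>" for \<beta> \<gamma> j
    using that by (auto simp: I_def span_zero)
  have finI: "finite (I \<beta>)" for \<beta>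
    using fin by (auto simp: I_def)
  have cardI: "real (card (I \<beta>)) = pairing_sum \<Phi> \<Delta> \<Delta>\<^sub>P \<beta> - 1" if "\<beta> \<in> \<Delta> - \<Delta>\<^sub>P" for \<beta>
  proof -
    \<comment> \<open>The extra index is new because 0 is not a root; it accounts for the 1 left
      over when 1 is subtracted from the 2 in \<open>pairing_sum_eq\<close>.\<close>
    have "(0, 1) \<notin> (SIGMA \<gamma>:levi_roots. {1..k \<beta> \<gamma>})"
      using levi_root zero_not_root by auto
    then have "card (I \<beta>) = 1 + (\<Sum>\<gamma>\<in>levi_roots. k \<beta> \<gamma>)"
      using fin by (simp add: I_def)
    then show ?thesis
      using that k by (simp add: pairing_sum_eq)
  qed
  \<comment> \<open>Decoding \<open>f\<close>: among the coordinates outside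
    \<open>\<Delta>\<^sub>P\<close>, only the one at \<open>\<beta>\<close> can be nonzero, and it
    equals \<open>j\<close>.\<close>
  have coef_f: "coef (f (\<beta>, \<gamma>, j)) \<delta> = (if \<delta> = \<beta> then real j else 0)"
    if "\<beta> \<in> \<Delta>" "\<gamma> \<in> span \<Delta>\<^sub>P" "\<delta> \<in> \<Delta> - \<Delta>\<^sub>P" for \<beta> \<gamma> j \<delta>
  proof -
    have "\<gamma> \<in> span \<Delta>" using that span_mono[OF parabolic_subset] by auto
    then show ?thesis using that by (simp add: f_def coef_add_simple levi_coef_eq_0)
  qed
  have "inj_on f (SIGMA \<beta>:\<Delta> - \<Delta>\<^sub>P. I \<beta>)"
  proof (rule inj_onI, clarsimp)
    fix \<beta> \<gamma> j \<beta>' \<gamma>' j'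
    assume h: "\<beta> \<in> \<Delta>" "\<beta> \<notin> \<Delta>\<^sub>P" "(\<gamma>, j) \<in> I \<beta>" "\<beta>' \<in> \<Delta>" "\<beta>' \<notin> \<Delta>\<^sub>P" "(\<gamma>', j') \<in> I \<beta>'"
      and eq: "f (\<beta>, \<gamma>, j) = f (\<beta>', \<gamma>', j')"
    \<comment> \<open>Both sides are the \<open>\<beta>\<close>-coordinate of the common image.
      Since \<open>j\<close> is at least 1, the default 0 is excluded, which forces
      \<open>\<beta> = \<beta>'\<close>.\<close>
    have "(if \<beta> = \<beta>' then real j' else 0) = real j"
      using coef_f[of \<beta> \<gamma> \<beta> j] coef_f[of \<beta>' \<gamma>' \<beta> j'] h index eq by auto
    then have "\<beta> = \<beta>'" "j = j'"
      using index(2)[OF h(3)] by (auto split: if_splits)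
    then show "\<beta> = \<beta>' \<and> \<gamma> = \<gamma>' \<and> j = j'"
      using eq by (simp add: f_def)
  qed
  moreover have "f ` (SIGMA \<beta>:\<Delta> - \<Delta>\<^sub>P. I \<beta>) \<subseteq> complementary_roots \<Phi> \<Delta> \<Delta>\<^sub>P"
  proof clarsimp
    fix \<beta> \<gamma> j
    assume h: "\<beta> \<in> \<Delta>" "\<beta> \<notin> \<Delta>\<^sub>P" "(\<gamma>, j) \<in> I \<beta>"
    have "f (\<beta>, \<gamma>, j) \<in> \<Phi>"
    proof (cases "(\<gamma>, j) = (0, 1)")
      case True
      then show ?thesis using h simple_subset by (auto simp: f_def)
    next
      case False
      then have \<gamma>: "\<gamma> \<in> levi_roots" and j: "j \<le> k \<beta> \<gamma>"
        using h by (auto simp: I_def)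
      \<comment> \<open>A multiple of \<open>\<beta>\<close> with vanishing
        \<open>\<beta>\<close>-coordinate would be 0, which is not a root.\<close>
      have "\<gamma> \<notin> span {\<beta>}"
      proof
        assume "\<gamma> \<in> span {\<beta>}"
        then obtain c where c: "\<gamma> = c *\<^sub>R \<beta>" by (auto simp: span_singleton)
        have "coef \<gamma> \<beta> = c"
          using coef_add_simple[of 0 \<beta> c \<beta>] h c
          by (simp add: span_zero real_vector.representation_zero)
        then have "\<gamma> = 0" using c \<gamma> h levi_coef_eq_0 by auto
        then show False using levi_root[OF \<gamma>] zero_not_root by simp
      qed
      then show ?thesis
        using root_string[of \<gamma> \<beta> j] levi_root[OF \<gamma>] h simple_subset j k[OF \<gamma>, of \<beta>]
        by (auto simp: f_def)
    qed
    then show "f (\<beta>, \<gamma>, j) \<in> complementary_roots \<Phi> \<Delta> \<Delta>\<^sub>P"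
      using h coef_f[of \<beta> \<gamma> \<beta> j] index[OF h(3)] by (intro complementary_rootI[of _ \<beta>]) auto
  qed
  ultimately have "card (SIGMA \<beta>:\<Delta> - \<Delta>\<^sub>P. I \<beta>) \<le> card (complementary_roots \<Phi> \<Delta> \<Delta>\<^sub>P)"
    using fin by (intro card_inj_on_le)
  then have "(\<Sum>\<beta>\<in>\<Delta> - \<Delta>\<^sub>P. card (I \<beta>)) \<le> card (complementary_roots \<Phi> \<Delta> \<Delta>\<^sub>P)"
    using finite_simple finI by simp
  then have "(\<Sum>\<beta>\<in>\<Delta> - \<Delta>\<^sub>P. real (card (I \<beta>))) \<le> real (card (complementary_roots \<Phi> \<Delta> \<Delta>\<^sub>P))"
    by (simp flip: of_nat_sum)
  then show ?thesis
    using cardI by simp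
qed

text \<open>The gcd divides each pairing sum and these are positive, so it is at most each of them;
  adding up over \<open>\<beta>\<close> reduces the claim to the first inequality.\<close>

lemma card_mult_Gcd_le_card:
  "int (card (\<Delta> - \<Delta>\<^sub>P)) * ((GCD \<beta>\<in>\<Delta> - \<Delta>\<^sub>P. \<lfloor>pairing_sum \<Phi> \<Delta> \<Delta>\<^sub>P \<beta>\<rfloor>) - 1)
     \<le> int (card (complementary_roots \<Phi> \<Delta> \<Delta>\<^sub>P))"
proof -
  let ?g = "GCD \<beta>\<in>\<Delta> - \<Delta>\<^sub>P. \<lfloor>pairing_sum \<Phi> \<Delta> \<Delta>\<^sub>P \<beta>\<rfloor>"
  have "of_int ?g \<le> pairing_sum \<Phi> \<Delta> \<Delta>\<^sub>P \<beta>" if \<beta>: "\<beta> \<in> \<Delta> - \<Delta>\<^sub>P" for \<beta>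
  proof -
    have "(\<Sum>\<gamma>\<in>levi_roots. - (\<gamma> \<bullet> coroot \<beta>)) \<ge> 0"
      using levi_pairing_nonpos[OF _ \<beta>] by (intro sum_nonneg) simp
    then have "pairing_sum \<Phi> \<Delta> \<Delta>\<^sub>P \<beta> \<ge> 2"
      using pairing_sum_eq \<beta> by simp
    then have "\<lfloor>pairing_sum \<Phi> \<Delta> \<Delta>\<^sub>P \<beta>\<rfloor> > 0"
      by linarith
    moreover have "?g dvd \<lfloor>pairing_sum \<Phi> \<Delta> \<Delta>\<^sub>P \<beta>\<rfloor>"
      using \<beta> by (intro Gcd_dvd) auto
    ultimately have "?g \<le> \<lfloor>pairing_sum \<Phi> \<Delta> \<Delta>\<^sub>P \<beta>\<rfloor>"
      by (intro zdvd_imp_le)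
    then show ?thesis
      by (simp add: le_floor_iff)
  qed
  \<comment> \<open>If \<open>\<Delta>\<^sub>P = \<Delta>\<close>, the gcd of the empty family is 0,
    but then both sums are empty and the cardinality factor vanishes.\<close>
  then have "(\<Sum>\<beta>\<in>\<Delta> - \<Delta>\<^sub>P. real_of_int ?g - 1) \<le> (\<Sum>\<beta>\<in>\<Delta> - \<Delta>\<^sub>P. pairing_sum \<Phi> \<Delta> \<Delta>\<^sub>P \<beta> - 1)"
    by (intro sum_mono) simp
  also have "\<dots> \<le> real (card (complementary_roots \<Phi> \<Delta> \<Delta>\<^sub>P))"
    by (rule sum_pairing_sum_le_card)
  finally have "real_of_int (int (card (\<Delta> - \<Delta>\<^sub>P)) * (?g - 1))
      \<le> real_of_int (int (card (complementary_roots \<Phi> \<Delta> \<Delta>\<^sub>P)))"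
    by simp
  then show ?thesis
    by (simp only: of_int_le_iff)
qed

end

theorem theorem3p18:
  fixes \<Phi> \<Delta> \<Delta>\<^sub>P :: "'a::euclidean_space set"
  assumes "root_system \<Phi>" and "crystallographic \<Phi>" and "reduced_roots \<Phi>"
    and "simple_roots \<Phi> \<Delta>"
    and "\<Delta>\<^sub>P \<subseteq> \<Delta>"
  shows "(\<Sum>\<beta>\<in>\<Delta> - \<Delta>\<^sub>P. (pairing_sum \<Phi> \<Delta> \<Delta>\<^sub>P \<beta> - 1))
           \<le> real (card (complementary_roots \<Phi> \<Delta> \<Delta>\<^sub>P)) \<and>
         int (card (\<Delta> - \<Delta>\<^sub>P)) * ((GCD \<beta>\<in>\<Delta> - \<Delta>\<^sub>P. \<lfloor>pairing_sum \<Phi> \<Delta> \<Delta>\<^sub>P \<beta>\<rfloor>) - 1)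
           \<le> int (card (complementary_roots \<Phi> \<Delta> \<Delta>\<^sub>P))"
proof -
  interpret parabolic_root_basis \<Phi> \<Delta> \<Delta>\<^sub>P
    using assms by unfold_locales
  show ?thesis
    using sum_pairing_sum_le_card card_mult_Gcd_le_card by blast
qed

end
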